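(* For every real number $c>0$, the skew-product $f:\mathbb{T}^2\to\mathbb{T}^2$ defined by $$f(x,y)=\left(2x-\lfloor 2x\rfloor,\ y+\frac{c}{|x-1/2|}-\left\lfloor y+\frac{c}{|x-1/2|}\right\rfloor\right)$$ (for $x\neq 1/2$) is topologically mixing.
   Context: $\mathbb{T}^2$ is the two-dimensional torus, obtained from $[0,1]\times[0,1]$ by identifying opposite sides; $\lfloor t\rfloor$ is the greatest integer less than or equal to $t$. The map $f$ is defined off the circle of singularities $\{x=1/2\}$. For a set $A\subset\mathbb{T}^2$, $f^n(A)$ denotes the set of points $f^n(p)$ with $p\in A$ for which $f^n(p)$ is defined. Such a map is topologically mixing if for every pair of non-empty open subsets $A,B$ of $\mathbb{T}^2$ there is $N>0$ such that $f^n(A)\cap B\neq\emptyset$ for all $n\geq N$. *)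

theory Defs
  imports "HOL-Analysis.Analysis"
begin

text \<open>
  The torus is the quotient of the closed unit square that identifies opposite sides. A class of
  identified points is represented by its unique member in the half-open square, so the map
  below is the quotient projection, and the topology is the quotient topology (not the
  subspace topology of the half-open square).
\<close>

definition torus_proj :: "real \<times> real \<Rightarrow> real \<times> real" where
  "torus_proj = (\<lambda>(x, y). (frac x, frac y))"

definition torus :: "(real \<times> real) topology" where
  "torus = topology (\<lambda>U. U \<subseteq> {0..<1} \<times> {0..<1} \<and>
     openin (top_of_set ({0..1} \<times> {0..1})) {p \<in> {0..1} \<times> {0..1}. torus_proj p \<in> U})"

lemma torus_proj_eq_iff:
  assumes "x \<in> {0..1}" "y \<in> {0..1}" "x' \<in> {0..1}" "y' \<in> {0..1}"
  shows "torus_proj (x, y) = torus_proj (x', y') \<longleftrightarrow>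
    (x = x' \<or> {x, x'} = {0, 1}) \<and> (y = y' \<or> {y, y'} = {0, 1})"
proof -
  have "frac s = frac t \<longleftrightarrow> s = t \<or> {s, t} = {0, 1}"
    if "s \<in> {0..1}" "t \<in> {0..1}" for s t :: real
  proof -
    have *: "frac r = (if r = 1 then 0 else r)" if "r \<in> {0..1}" for r :: real
      using that by (auto simp: frac_eq frac_1)
    show ?thesis
      using that by (simp only: *) (auto simp: doubleton_eq_iff)
  qed
  with assms show ?thesis by (auto simp: torus_proj_def)
qed

lemma openin_torus:
  "openin torus U \<longleftrightarrow> U \<subseteq> {0..<1} \<times> {0..<1} \<and>
     openin (top_of_set ({0..1} \<times> {0..1})) {p \<in> {0..1} \<times> {0..1}. torus_proj p \<in> U}"
proof -
  let ?Q = "{0..1} \<times> {0..1} :: (real \<times> real) set"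
  let ?P = "\<lambda>U. U \<subseteq> {0..<1} \<times> {0..<1} \<and>
     openin (top_of_set ?Q) {p \<in> ?Q. torus_proj p \<in> U}"
  have "istopology ?P"
    unfolding istopology_def
  proof (intro conjI allI impI)
    fix S T assume S: "?P S" and T: "?P T"
    then show "S \<inter> T \<subseteq> {0..<1} \<times> {0..<1}" by blast
    have "{p \<in> ?Q. torus_proj p \<in> S \<inter> T} =
        {p \<in> ?Q. torus_proj p \<in> S} \<inter> {p \<in> ?Q. torus_proj p \<in> T}"
      by blast
    then show "openin (top_of_set ?Q) {p \<in> ?Q. torus_proj p \<in> S \<inter> T}"
      using S T by (simp only: openin_Int)
  next
    fix K assume K: "\<forall>S\<in>K. ?P S"
    then show "\<Union>K \<subseteq> {0..<1} \<times> {0..<1}" by blast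
    have "{p \<in> ?Q. torus_proj p \<in> \<Union>K} = (\<Union>S\<in>K. {p \<in> ?Q. torus_proj p \<in> S})"
      by blast
    then show "openin (top_of_set ?Q) {p \<in> ?Q. torus_proj p \<in> \<Union>K}"
      using K by (auto simp only:)
  qed
  then show ?thesis
    unfolding torus_def by (simp only: topology_inverse')
qed

lemma topspace_torus: "topspace torus = {0..<1} \<times> {0..<1}"
proof -
  have "{p \<in> {0..1} \<times> {0..1}. torus_proj p \<in> {0..<1} \<times> {0..<1}} = {0..1} \<times> {0..1}"
    by (auto simp: torus_proj_def frac_lt_1)
  then have "openin torus ({0..<1} \<times> {0..<1})"
    by (simp add: openin_torus)
  then show ?thesis
    using openin_subset[of torus] openin_torus[of "topspace torus"] by auto
qed

lemma quotient_map_torus_proj: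
  "quotient_map (top_of_set ({0..1} \<times> {0..1})) torus torus_proj"
proof -
  have "torus_proj p = p" if "p \<in> {0..<1} \<times> {0..<1}" for p
    using that by (auto simp: torus_proj_def frac_eq)
  then have "{0..<1} \<times> {0..<1} \<subseteq> torus_proj ` ({0..1} \<times> {0..1})"
    by (intro subsetI rev_image_eqI) auto
  moreover have "torus_proj ` ({0..1} \<times> {0..1}) \<subseteq> {0..<1} \<times> {0..<1}"
    by (auto simp: torus_proj_def frac_lt_1)
  ultimately show ?thesis
    by (simp add: quotient_map_def topspace_torus openin_torus)
qed

primrec partial_iterate :: "('a \<rightharpoonup> 'a) \<Rightarrow> nat \<Rightarrow> 'a \<rightharpoonup> 'a" where
  "partial_iterate f 0 = Some"
| "partial_iterate f (Suc n) = f \<circ>\<^sub>m partial_iterate f n"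

definition iterate_image :: "('a \<rightharpoonup> 'a) \<Rightarrow> nat \<Rightarrow> 'a set \<Rightarrow> 'a set" where
  "iterate_image f n A = {q. \<exists>p\<in>A. partial_iterate f n p = Some q}"

definition topologically_mixing :: "'a topology \<Rightarrow> ('a \<rightharpoonup> 'a) \<Rightarrow> bool" where
  "topologically_mixing X f \<longleftrightarrow>
     (\<forall>A B. openin X A \<and> A \<noteq> {} \<and> openin X B \<and> B \<noteq> {} \<longrightarrow>
        (\<exists>N>0. \<forall>n\<ge>N. iterate_image f n A \<inter> B \<noteq> {}))"

definition skew_product :: "real \<Rightarrow> real \<times> real \<rightharpoonup> real \<times> real" where
  "skew_product c = (\<lambda>(x :: real, y :: real).
     if x = 1/2 then None
     else Some (2 * x - of_int \<lfloor>2 * x\<rfloor>,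
                y + c / \<bar>x - 1/2\<bar> - of_int \<lfloor>y + c / \<bar>x - 1/2\<bar>\<rfloor>))"

end

theory Submission
  imports Defs "HOL-Real_Asymp.Real_Asymp"
begin

text \<open>
  Off the singularity, \<open>f\<^sup>n (x, y) = (2\<^sup>n x, y + S\<^sub>n x)\<close> modulo 1, where \<open>S\<^sub>n\<close> is a Birkhoff sum of
  \<open>c / \<bar>x - 1/2\<bar>\<close> along the doubling map. Choose a dyadic \<open>p\<close>, inside the given open set, that
  reaches \<open>1/2\<close> for the first time at time \<open>m\<close>. The points \<open>x = p + t / 2\<^sup>m\<^sup>+\<^sup>j\<close> with \<open>0 < t < 1\<close>
  are at distance \<open>t / 2\<^sup>j\<close> from \<open>1/2\<close> at time \<open>m\<close> and at position \<open>t\<close> at time \<open>m + j\<close>. On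
  an interval \<open>a \<le> t \<le> b\<close>, the time \<open>m\<close> term \<open>c 2\<^sup>j / t\<close> oscillates by a multiple of \<open>2\<^sup>j\<close>, while
  the remaining terms oscillate by \<open>O(j)\<close>. So for large \<open>j\<close> the intermediate value theorem makes
  \<open>S\<^sub>m\<^sub>+\<^sub>j\<close> take every value modulo 1 on that interval.
\<close>

section \<open>Iterates of the skew product as Birkhoff sums\<close>

definition birkhoff_sum :: "real \<Rightarrow> nat \<Rightarrow> real \<Rightarrow> real" where
  "birkhoff_sum c n x = (\<Sum>i<n. c / \<bar>frac (2 ^ i * x) - 1/2\<bar>)"

lemma frac_eqI:
  fixes x :: real
  assumes "x = of_int k + r" "0 \<le> r" "r < 1"
  shows "frac x = r"
  using assms by (simp add: frac_unique_iff)

lemma frac_mult_frac: "frac (2 * frac x) = frac (2 * x :: real)"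
proof -
  have "2 * frac x = 2 * x - of_int (2 * \<lfloor>x\<rfloor>)"
    by (simp add: frac_def algebra_simps)
  then show ?thesis
    by (metis diff_eq_eq frac_add_of_int_right)
qed

lemma partial_iterate_skew_product:
  assumes "x \<in> {0..<1}" "y \<in> {0..<1}" "\<And>i. i < n \<Longrightarrow> frac (2 ^ i * x) \<noteq> 1/2"
  shows "partial_iterate (skew_product c) n (x, y) =
    Some (frac (2 ^ n * x), frac (y + birkhoff_sum c n x))"
  using assms(3)
proof (induction n)
  case 0
  then show ?case using assms(1,2) by (simp add: birkhoff_sum_def frac_eq)
next
  case (Suc n)
  then show ?case
    by (simp add: map_comp_def skew_product_def birkhoff_sum_def add.assoc
        flip: frac_def) (simp add: frac_mult_frac mult.assoc)
qed

section \<open>Horizontal segments in open sets of the torus\<close>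

lemma openin_torus_horizontal_segment:
  assumes "openin torus U" "U \<noteq> {}"
  obtains u v y :: real where "0 < u" "u < v" "v < 1" "0 \<le> y" "y < 1"
    "\<And>x. x \<in> {u..v} \<Longrightarrow> (x, y) \<in> U"
proof -
  let ?Q = "{0..1} \<times> {0..1} :: (real \<times> real) set"
  let ?I = "{0<..<1} \<times> {0<..<1} :: (real \<times> real) set"
  have proj: "torus_proj p = p" if "p \<in> {0..<1} \<times> {0..<1}" for p
    using that by (auto simp: torus_proj_def frac_eq)
  obtain W where W: "open W" "{p \<in> ?Q. torus_proj p \<in> U} = ?Q \<inter> W"
    using assms(1) by (auto simp: openin_torus openin_open)
  have "U \<subseteq> {0..<1} \<times> {0..<1}"
    using assms(1) by (simp add: openin_torus)
  with assms(2) obtain q where q: "q \<in> U" "q \<in> {0..<1} \<times> {0..<1}"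
    by blast
  then have "q \<in> {p \<in> ?Q. torus_proj p \<in> U}"
    using proj[OF q(2)] by auto
  then have "q \<in> W" using W by blast
  \<comment> \<open>The point \<open>q\<close> may lie on a glued edge. Density of the open square
    in the closed one yields a point of \<open>W\<close> off the edges, where
    \<open>torus_proj\<close> is the identity.\<close>
  moreover have "q \<in> closure ?I"
    using q(2) by (auto simp: closure_Times)
  ultimately have "W \<inter> ?I \<noteq> {}"
    using W(1) by (metis IntI empty_iff open_Int_closure_eq_empty)
  then obtain x0 y0 where p0: "(x0, y0) \<in> W \<inter> ?I"
    by (metis equals0I surj_pair)
  have "open (W \<inter> ?I)"
    using W(1) by (intro open_Int open_Times) auto
  with p0 obtain X Y where XY: "open X" "open Y" "(x0, y0) \<in> X \<times> Y" "X \<times> Y \<subseteq> W \<inter> ?I"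
    by (metis open_prod_elim mem_Times_iff)
  then obtain e where e: "e > 0" "cball x0 e \<subseteq> X"
    using open_contains_cball by blast
  have seg: "(x, y0) \<in> W \<inter> ?I" if "x \<in> {x0..x0 + e}" for x
  proof -
    have "x \<in> cball x0 e" using that by (simp add: dist_real_def)
    then show ?thesis using e XY by blast
  qed
  show thesis
  proof
    show "0 < x0" "x0 < x0 + e" "x0 + e < 1" "0 \<le> y0" "y0 < 1"
      using seg[of x0] seg[of "x0 + e"] e(1) by auto
    fix x assume "x \<in> {x0..x0 + e}"
    then have *: "(x, y0) \<in> W" "(x, y0) \<in> ?I" using seg by auto
    then have "(x, y0) \<in> ?Q \<inter> W" by auto
    then have "torus_proj (x, y0) \<in> U" using W(2) by blast
    then show "(x, y0) \<in> U" using proj[of "(x, y0)"] *(2) by auto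
  qed
qed

section \<open>Dyadic intervals and the orbit before time \<open>m\<close>\<close>

lemma dyadic_interval_between:
  fixes u v :: real
  assumes "u < v"
  obtains m :: nat and q :: int where "u < of_int q / 2 ^ m" "(of_int q + 1) / 2 ^ m < v"
proof -
  obtain m :: nat where "2 / (v - u) < 2 ^ m"
    using real_arch_pow[of 2] by auto
  then have m: "2 < 2 ^ m * (v - u)"
    using assms by (simp add: field_simps)
  \<comment> \<open>The least integer above \<open>2 ^ m * u\<close>. The rescaled interval is
    longer than 2, so it contains \<open>q + 1\<close> as well.\<close>
  define q where "q = \<lfloor>2 ^ m * u\<rfloor> + 1"
  have "2 ^ m * u < of_int q" "of_int q \<le> 2 ^ m * u + 1"
    unfolding q_def by linarith+
  with m have "u < of_int q / 2 ^ m" "(of_int q + 1) / 2 ^ m < v"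
    by (simp_all add: field_simps)
  then show thesis by (rule that)
qed

lemma dyadic_interior_not_Ints:
  fixes x :: real
  assumes "of_int q < 2 ^ m * x" "2 ^ m * x < of_int q + 1" "i \<le> m"
  shows "2 ^ i * x \<notin> \<int>"
proof
  assume "2 ^ i * x \<in> \<int>"
  then have "2 ^ (m - i) * (2 ^ i * x) \<in> \<int>"
    by simp
  also have "2 ^ (m - i) * (2 ^ i * x) = 2 ^ m * x"
    using assms(3) by (simp flip: power_add mult.assoc)
  finally obtain k where "2 ^ m * x = of_int k"
    by (auto elim: Ints_cases)
  with assms show False by simp
qed

text \<open>A visit to 1/2 at time \<open>i\<close> would make \<open>2 ^ Suc i * x\<close> an
  integer, which is impossible because \<open>Suc i\<close> is at most \<open>m\<close>.\<close>

lemma dyadic_interior_frac_neq_half: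
  fixes x :: real
  assumes "of_int q < 2 ^ m * x" "2 ^ m * x < of_int q + 1" "i < m"
  shows "frac (2 ^ i * x) \<noteq> 1/2"
proof
  assume "frac (2 ^ i * x) = 1/2"
  then have "2 ^ Suc i * x = of_int (2 * \<lfloor>2 ^ i * x\<rfloor> + 1)"
    by (simp add: frac_def)
  then have "2 ^ Suc i * x \<in> \<int>"
    by (metis Ints_of_int)
  then show False
    using dyadic_interior_not_Ints[OF assms(1,2), of "Suc i"] assms(3) by simp
qed

text \<open>Inside a dyadic interval of level \<open>m\<close>, the first \<open>m\<close> orbit
  points avoid both the jump of \<open>frac\<close> at the integers and the pole at 1/2.\<close>

lemma continuous_on_birkhoff_sum:
  "continuous_on {x. of_int q < 2 ^ m * x \<and> 2 ^ m * x < of_int q + 1} (birkhoff_sum c m)"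
proof -
  have "isCont (\<lambda>x. c / \<bar>frac (2 ^ i * x) - 1/2\<bar>) x"
    if x: "of_int q < 2 ^ m * x" "2 ^ m * x < of_int q + 1" and i: "i < m" for i x
  proof -
    have "isCont (\<lambda>x. frac (2 ^ i * x)) x"
    proof (rule isCont_o2[where g = frac])
      show "isCont (\<lambda>x. 2 ^ i * x) x"
        by (intro continuous_intros)
      show "isCont frac (2 ^ i * x)"
        using dyadic_interior_not_Ints[OF x] i by (intro continuous_frac) auto
    qed
    then show ?thesis
      using dyadic_interior_frac_neq_half[OF x i]
      by (intro isCont_divide isCont_rabs isCont_diff continuous_const) auto
  qed
  then show ?thesis
    unfolding birkhoff_sum_def
    by (intro continuous_on_sum continuous_at_imp_continuous_on) auto
qed

section \<open>Orbit and sum after the passage near 1/2\<close>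

lemma frac_after_singularity:
  fixes t x :: real
  assumes x: "2 ^ m * x = of_int q + 1/2 + t / 2 ^ Suc k" and t: "0 < t" "t < 1"
  shows "frac (2 ^ m * x) = 1/2 + t / 2 ^ Suc k"
    and "l \<le> k \<Longrightarrow> frac (2 ^ (m + Suc l) * x) = 2 ^ l * t / 2 ^ k"
proof -
  define s where "s = t / 2 ^ Suc k"
  have "0 < s" "s < 1/2"
    using t less_le_trans[OF t(2) one_le_power[of "2::real" k]] by (simp_all add: s_def field_simps)
  then show "frac (2 ^ m * x) = 1/2 + t / 2 ^ Suc k"
    using x unfolding s_def[symmetric] by (intro frac_eqI[where k = q]) auto
  assume l: "l \<le> k"
  have "2 ^ (m + Suc l) * x = 2 ^ Suc l * (2 ^ m * x)"
    by (simp add: power_add)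
  also have "\<dots> = of_int (2 ^ Suc l * q + 2 ^ l) + 2 ^ l * t / 2 ^ k"
    unfolding x by (simp add: field_simps)
  finally show "frac (2 ^ (m + Suc l) * x) = 2 ^ l * t / 2 ^ k"
  proof (rule frac_eqI)
    have "2 ^ l * t < 2 ^ k"
      using t power_increasing[OF l, of "2::real"]
      by (smt (verit) mult_less_cancel_left2 zero_less_power)
    then show "2 ^ l * t / 2 ^ k < 1" by simp
  qed (use t in auto)
qed

text \<open>At least one doubling is still to come before the orbit reaches \<open>t\<close>. This
  keeps the intermediate positions uniformly away from 1/2.\<close>

lemma power_div_power_le_half:
  assumes "l < k" "0 \<le> t"
  shows "2 ^ l * t / 2 ^ k \<le> t / (2::real)"
proof -
  have "(2::real) ^ Suc l \<le> 2 ^ k"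
    using assms(1) by (intro power_increasing) auto
  then have "2 ^ Suc l * t \<le> 2 ^ k * t"
    using assms(2) by (rule mult_right_mono)
  then show ?thesis
    by (simp add: field_simps)
qed

text \<open>The sum splits at time \<open>m\<close>. The middle term is the large one; afterwards
  the orbit stays below 1/2, which fixes the sign inside the absolute value.\<close>

lemma birkhoff_sum_near_singularity:
  fixes t x :: real
  assumes x: "2 ^ m * x = of_int q + 1/2 + t / 2 ^ Suc k" and t: "0 < t" "t < 1"
  shows "birkhoff_sum c (m + Suc k) x =
    birkhoff_sum c m x + c * 2 ^ Suc k / t + (\<Sum>l<k. c / (1/2 - 2 ^ l * t / 2 ^ k))"
proof -
  let ?g = "\<lambda>i. c / \<bar>frac (2 ^ i * x) - 1/2\<bar>"
  have "birkhoff_sum c (m + Suc k) x = birkhoff_sum c m x + (\<Sum>l<Suc k. ?g (m + l))"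
    unfolding birkhoff_sum_def by (induction k) simp_all
  also have "(\<Sum>l<Suc k. ?g (m + l)) = ?g m + (\<Sum>l<k. ?g (m + Suc l))"
    by (subst sum.lessThan_Suc_shift) simp
  also have "?g m = c * 2 ^ Suc k / t"
    using t by (simp add: frac_after_singularity(1)[OF assms])
  also have "(\<Sum>l<k. ?g (m + Suc l)) = (\<Sum>l<k. c / (1/2 - 2 ^ l * t / 2 ^ k))"
  proof (intro sum.cong refl)
    fix l assume "l \<in> {..<k}"
    then have "frac (2 ^ (m + Suc l) * x) = 2 ^ l * t / 2 ^ k" "2 ^ l * t / 2 ^ k \<le> t / 2"
      using frac_after_singularity(2)[OF assms, of l] power_div_power_le_half[of l k t] t by auto
    with t(2) have "\<bar>frac (2 ^ (m + Suc l) * x) - 1/2\<bar> = 1/2 - 2 ^ l * t / 2 ^ k"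
      by linarith
    then show "?g (m + Suc l) = c / (1/2 - 2 ^ l * t / 2 ^ k)"
      by simp
  qed
  finally show ?thesis by simp
qed

section \<open>Intermediate values modulo 1 and mixing\<close>

lemma IVT_frac:
  fixes g :: "real \<Rightarrow> real"
  assumes "a \<le> b" "continuous_on {a..b} g" "g b + 1 \<le> g a" "0 \<le> z" "z < 1"
  obtains t where "t \<in> {a..b}" "frac (g t) = z"
proof -
  \<comment> \<open>The least integer translate of \<open>z\<close> that is at least
    \<open>g b\<close>; it is below \<open>g b + 1\<close>, hence at most
    \<open>g a\<close>.\<close>
  define w where "w = of_int \<lceil>g b - z\<rceil> + z"
  have "g b \<le> w" "w \<le> g a"
    unfolding w_def using assms(3) by linarith+
  then obtain t where "a \<le> t" "t \<le> b" "g t = w"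
    using IVT2'[of g b w a] assms(1,2) by auto
  with assms(4,5) show thesis
    by (intro that[of t]) (auto simp: w_def intro!: frac_eqI[OF refl])
qed

theorem theorem1:
  fixes c :: real
  assumes "c > 0"
  shows "topologically_mixing torus (skew_product c)"
  unfolding topologically_mixing_def
proof (intro allI impI, elim conjE)
  fix A B
  assume A: "openin torus A" "A \<noteq> {}" and B: "openin torus B" "B \<noteq> {}"
  obtain u v y where uv: "0 < u" "u < v" "v < 1" and y: "0 \<le> y" "y < 1"
    and segA: "\<And>x. x \<in> {u..v} \<Longrightarrow> (x, y) \<in> A"
    using openin_torus_horizontal_segment[OF A] by metis
  obtain a b z where ab: "0 < a" "a < b" "b < 1" and z: "0 \<le> z" "z < 1"
    and segB: "\<And>x. x \<in> {a..b} \<Longrightarrow> (x, z) \<in> B"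
    using openin_torus_horizontal_segment[OF B] by metis
  obtain m :: nat and q :: int
    where mq: "u < of_int q / 2 ^ m" "(of_int q + 1) / 2 ^ m < v"
    using dyadic_interval_between[OF uv(2)] by metis
  \<comment> \<open>The midpoint of the dyadic interval, which reaches 1/2 at time \<open>m\<close>.
    Since \<open>d\<close> is a quarter of the length, \<open>{p..p + d}\<close> is a compact subset
    of the open interval.\<close>
  define p where "p = (of_int q + 1/2 :: real) / 2 ^ m"
  define d where "d = 1 / (4 * 2 ^ m :: real)"
  have D: "{p..p + d} \<subseteq> {x. of_int q < 2 ^ m * x \<and> 2 ^ m * x < of_int q + 1}"
    by (auto simp: p_def d_def field_simps)
  have "compact (birkhoff_sum c m ` {p..p + d})"
    using continuous_on_subset[OF continuous_on_birkhoff_sum D]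
    by (intro compact_continuous_image) auto
  then obtain M where M: "\<And>x. x \<in> {p..p + d} \<Longrightarrow> \<bar>birkhoff_sum c m x\<bar> \<le> M"
    using bounded_real compact_imp_bounded by (metis image_eqI)
  \<comment> \<open>\<open>C * 2 ^ Suc k\<close> is the drop of the time \<open>m\<close> term from
    \<open>t = a\<close> to \<open>t = b\<close>.\<close>
  define C where "C = c * (1 / a - 1 / b)"
  have "C > 0"
    unfolding C_def using ab assms by (intro mult_pos_pos) (auto simp: field_simps)
  \<comment> \<open>Bounds each term after time \<open>m\<close>, where positions are at most
    \<open>b / 2 < 1/2\<close>.\<close>
  define K where "K = c / (1/2 - b/2)"
  \<comment> \<open>The drop must outweigh the later terms (\<open>k * K\<close>) and the variation
    of the earlier ones (\<open>2 * M\<close>), and leave 1 for a full turn of the circle.\<close>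
  have "eventually (\<lambda>k. real k * K + 2 * M + 1 \<le> C * 2 ^ Suc k) at_top"
    using \<open>C > 0\<close> by real_asymp
  then obtain k0 where k0: "\<And>k. k \<ge> k0 \<Longrightarrow> real k * K + 2 * M + 1 \<le> C * 2 ^ Suc k"
    by (auto simp: eventually_at_top_linorder)
  have "iterate_image (skew_product c) n A \<inter> B \<noteq> {}" if n: "n \<ge> m + k0 + 2" for n
  proof -
    \<comment> \<open>\<open>Suc k\<close> is the number of steps from time \<open>m\<close> to time
      \<open>n\<close>. Having \<open>k \<ge> 1\<close> makes the offset of \<open>x t\<close> from
      \<open>p\<close> at most \<open>d\<close>.\<close>
    define k where "k = n - m - 1"
    have k: "n = m + Suc k" "k \<ge> k0" "k \<ge> 1"
      using n by (auto simp: k_def)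
    define x where "x t = p + t / (2 ^ m * 2 ^ Suc k)" for t :: real
    define R where "R t = (\<Sum>l<k. c / (1/2 - 2 ^ l * t / 2 ^ k))" for t :: real
    define g where
      "g t = y + (birkhoff_sum c m (x t) + c * 2 ^ Suc k / t + R t)" for t
    have x_eq: "2 ^ m * x t = of_int q + 1/2 + t / 2 ^ Suc k" for t
      by (simp add: x_def p_def field_simps)
    have x_in: "x t \<in> {p..p + d}" if "t \<in> {a..b}" for t
    proof -
      have "(2::real) ^ 1 \<le> 2 ^ k" using k(3) by (intro power_increasing) auto
      then have "t * 4 \<le> 2 * 2 ^ k" using that ab by auto
      then show ?thesis
        using that ab by (auto simp: x_def d_def field_simps)
    qed
    have below: "2 ^ l * t / 2 ^ k \<le> b / 2" if "l < k" "t \<in> {a..b}" for l t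
      using power_div_power_le_half[of l k t] that ab by auto
    have "continuous_on {a..b} g"
      unfolding g_def R_def
    proof (intro continuous_intros)
      show "continuous_on {a..b} (\<lambda>t. birkhoff_sum c m (x t))"
      proof (rule continuous_on_compose2[OF continuous_on_birkhoff_sum[of q m c]])
        show "continuous_on {a..b} x"
          unfolding x_def by (intro continuous_intros) auto
      qed (use x_in D in blast)
    qed (use ab below in \<open>force+\<close>)
    \<comment> \<open>One-sided bounds on the later terms suffice: \<open>R b\<close> is at most
      \<open>k * K\<close> and \<open>R a\<close> is nonnegative.\<close>
    moreover have "g b + 1 \<le> g a"
    proof -
      have "0 \<le> c / (1/2 - 2 ^ l * t / 2 ^ k) \<and> c / (1/2 - 2 ^ l * t / 2 ^ k) \<le> K"
        if "l < k" "t \<in> {a..b}" for l t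
      proof -
        have "0 < 1/2 - b/2" "1/2 - b/2 \<le> 1/2 - 2 ^ l * t / 2 ^ k"
          using below[OF that] ab by linarith+
        then show ?thesis
          unfolding K_def using assms
          by (intro conjI divide_left_mono mult_pos_pos divide_nonneg_nonneg) linarith+
      qed
      then have "R b \<le> (\<Sum>l<k. K)" "0 \<le> R a"
        unfolding R_def using ab by (intro sum_mono sum_nonneg; simp)+
      moreover have "c * 2 ^ Suc k / a - c * 2 ^ Suc k / b = C * 2 ^ Suc k"
        by (simp add: C_def algebra_simps)
      moreover have "\<bar>birkhoff_sum c m (x a)\<bar> \<le> M" "\<bar>birkhoff_sum c m (x b)\<bar> \<le> M"
        using M x_in ab by auto
      ultimately show ?thesis
        using k0[OF k(2)] by (auto simp: g_def)
    qed
    ultimately obtain t where t: "t \<in> {a..b}" "frac (g t) = z"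
      using IVT_frac[of a b g z] ab z by auto
    then have t01: "0 < t" "t < 1"
      using ab by auto
    have "of_int q < 2 ^ m * x t" "2 ^ m * x t < of_int q + 1"
      using x_in[OF t(1)] D by auto
    then have "of_int q / 2 ^ m < x t" "x t < (of_int q + 1) / 2 ^ m"
      by (simp_all add: field_simps)
    with mq have "x t \<in> {u..v}"
      by simp
    then have "(x t, y) \<in> A" "x t \<in> {0..<1}"
      using segA uv by auto
    \<comment> \<open>Before time \<open>m\<close> the point is interior to its dyadic interval; at
      time \<open>m\<close> its offset from 1/2 is positive; later it is at most
      \<open>b / 2\<close>.\<close>
    have "frac (2 ^ i * x t) \<noteq> 1/2" if "i < n" for i
    proof (cases "i < m")
      case True
      then show ?thesis
        using dyadic_interior_frac_neq_half[of q m "x t" i] x_in[OF t(1)] D by auto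
    next
      case False
      show ?thesis
      proof (cases "i = m")
        case True
        then show ?thesis
          using frac_after_singularity(1)[OF x_eq t01] t01 by simp
      next
        case False
        with \<open>\<not> i < m\<close> that k obtain l where "i = m + Suc l" "l < k"
          by (metis add_less_cancel_left less_imp_Suc_add linorder_neqE_nat add_Suc_right Suc_less_eq)
        then show ?thesis
          using frac_after_singularity(2)[OF x_eq t01, of l] below[of l t] t(1) ab by auto
      qed
    qed
    then have "partial_iterate (skew_product c) n (x t, y) =
        Some (frac (2 ^ n * x t), frac (y + birkhoff_sum c n (x t)))"
      using \<open>x t \<in> {0..<1}\<close> y by (intro partial_iterate_skew_product) auto
    also have "frac (2 ^ n * x t) = t"
      using frac_after_singularity(2)[OF x_eq t01, of k] by (simp add: k(1))
    also have "y + birkhoff_sum c n (x t) = g t"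
      unfolding k(1) birkhoff_sum_near_singularity[OF x_eq t01] g_def R_def ..
    finally have "(t, z) \<in> iterate_image (skew_product c) n A"
      using \<open>(x t, y) \<in> A\<close> t(2) unfolding iterate_image_def by blast
    then show ?thesis using segB t(1) by blast
  qed
  then show "\<exists>N>0. \<forall>n\<ge>N. iterate_image (skew_product c) n A \<inter> B \<noteq> {}"
    by (intro exI[of _ "m + k0 + 2"]) auto
qed

end
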